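(* For every separable metric space $(M,d)$ there exists a map $f:M\to c_0$ such that for all $x,y\in M$ with $x\ne y$, $$d(x,y)<\|f(x)-f(y)\|<2\,d(x,y).$$
   Context: $c_0$ is the Banach space of real sequences converging to $0$ with the sup norm $\|\cdot\|$. *)

theory Defs
  imports "HOL-Analysis.Analysis"
begin

text \<open>
  As \<open>nat\<close> is discrete, \<^typ>\<open>nat \<Rightarrow>\<^sub>C real\<close> is the Banach space of bounded real sequences under
  the sup norm. The space \<open>c\<^sub>0\<close> is its closed subspace of null sequences, with the inherited norm.
\<close>

definition c0 :: "(nat \<Rightarrow>\<^sub>C real) set"
  where "c0 = {u. apply_bcontfun u \<longlonglongrightarrow> 0}"

lemma c0_surj:
  assumes "a \<longlonglongrightarrow> (0::real)"
  shows "\<exists>u\<in>c0. apply_bcontfun u = a"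
proof -
  have "bounded (range a)"
    using assms convergentI convergent_imp_bounded by blast
  then have "a \<in> bcontfun"
    by (simp add: bcontfun_def)
  then show ?thesis
    using assms by (intro bexI[of _ "Bcontfun a"]) (auto simp: c0_def Bcontfun_inverse)
qed

lemma norm_bcontfun_eq_SUP: "norm (u :: nat \<Rightarrow>\<^sub>C real) = (SUP n. \<bar>apply_bcontfun u n\<bar>)"
  by (simp add: norm_bcontfun_def dist_bcontfun.rep_eq)

lemma subspace_c0: "subspace c0"
  unfolding subspace_def c0_def
  by (auto intro!: tendsto_eq_intros simp: plus_bcontfun.rep_eq scaleR_bcontfun.rep_eq
      zero_bcontfun.rep_eq)

lemma complete_c0: "complete c0"
proof -
  have "u \<in> c0" if u: "\<forall>n. x n \<in> c0" and lim: "x \<longlonglongrightarrow> u" for x and u :: "nat \<Rightarrow>\<^sub>C real"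
  proof -
    have "apply_bcontfun u \<longlonglongrightarrow> 0"
    proof (rule LIMSEQ_I)
      fix r :: real assume "0 < r"
      then obtain n where n: "norm (x n - u) < r / 2"
        using LIMSEQ_D[OF lim, of "r / 2"] by auto
      obtain N where N: "\<And>k. k \<ge> N \<Longrightarrow> \<bar>x n k\<bar> < r / 2"
        using u \<open>0 < r\<close> LIMSEQ_D[of "apply_bcontfun (x n)" 0 "r / 2"] by (auto simp: c0_def)
      have "norm (u k - 0) < r" if "k \<ge> N" for k
        using N[OF that] n norm_bounded[of "x n - u" k] by (simp add: minus_bcontfun.rep_eq)
      then show "\<exists>N. \<forall>k\<ge>N. norm (u k - 0) < r" by blast
    qed
    then show ?thesis by (simp add: c0_def)
  qed
  then have cl: "closed c0"
    unfolding closed_sequential_limits by blast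
  show ?thesis
  proof (rule completeI)
    fix x :: "nat \<Rightarrow> nat \<Rightarrow>\<^sub>C real"
    assume x: "\<forall>n. x n \<in> c0" and "Cauchy x"
    then obtain g where "uniform_limit UNIV x g sequentially"
      using uniformly_convergent_eq_cauchy[of "\<lambda>_. True" x]
      unfolding Cauchy_def uniform_limit_sequentially_iff
      by (metis dist_fun_lt_imp_dist_val_lt)
    from uniform_limit_bcontfunE[OF this sequentially_bot]
    obtain u where "x \<longlonglongrightarrow> u" by metis
    then show "\<exists>u\<in>c0. x \<longlonglongrightarrow> u"
      using cl x closed_sequentially by blast
  qed
qed

end

theory Submission
  imports Defs
begin

text \<open>
  Let \<open>F\<^sub>n\<close> be the first \<open>n + 1\<close> points of a dense sequence and \<open>\<delta>\<^sub>n = 1 / (n + 1)\<close>. A function of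
  Lipschitz constant below \<open>2\<close> that is at most \<open>\<delta>\<^sub>n\<close> on \<open>F\<^sub>n\<close> is small at every point once \<open>n\<close> is
  large, so if each stage \<open>n\<close> contributes finitely many such coordinates, the coordinates at a point
  form a null sequence. Write \<open>r\<^sub>n\<close> for the distance to \<open>F\<^sub>n\<close>. Stage \<open>n\<close> serves the pairs with
  \<open>d x y < 2 (r\<^sub>n x + r\<^sub>n y) + \<delta>\<^sub>n\<close> but \<open>d x y \<ge> 2 (r\<^sub>m x + r\<^sub>m y) + \<delta>\<^sub>m\<close>, \<open>m = n + 1\<close>, and every pair is
  served at some stage. The second condition bounds such pairs, so they split into
  finitely many classes in which the nearest points \<open>p, q\<close> of \<open>F\<^sub>m\<close> are fixed and \<open>d x y\<close> and \<open>r\<^sub>n x\<close>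
  are nearly constant. If \<open>(x, y)\<close> and \<open>(x', y')\<close> lie in one class, then going from \<open>y\<close> to \<open>y'\<close>
  through \<open>q\<close> and from \<open>x\<close> to \<open>x'\<close> through \<open>p\<close> bounds \<open>d x y'\<close> from below in two ways, and the mean of
  the two bounds exceeds \<open>d x y / 2\<close>. Hence the two projections of the class are far
  enough apart for a difference of two bumps to separate them by more than \<open>d x y\<close>.
\<close>

section \<open>Distance to a set of points\<close>

definition (in Metric_space) infd :: "'a set \<Rightarrow> 'a \<Rightarrow> real"
  where "infd U z = (INF u\<in>U. d z u)"

lemma (in Metric_space) infd_le: "u \<in> U \<Longrightarrow> infd U z \<le> d z u"
  unfolding infd_def by (rule cINF_lower) (auto intro!: bdd_belowI[of _ 0])

lemma (in Metric_space) infd_greatest: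
  "U \<noteq> {} \<Longrightarrow> (\<And>u. u \<in> U \<Longrightarrow> c \<le> d z u) \<Longrightarrow> c \<le> infd U z"
  unfolding infd_def by (rule cINF_greatest)

lemma (in Metric_space) infd_nonneg: "U \<noteq> {} \<Longrightarrow> 0 \<le> infd U z"
  by (rule infd_greatest) auto

lemma (in Metric_space) infd_zero: "u \<in> U \<Longrightarrow> U \<subseteq> M \<Longrightarrow> infd U u = 0"
  using infd_le[of u U u] infd_nonneg[of U u] by (metis antisym empty_iff mdist_zero subsetD)

lemma (in Metric_space) infd_triangle:
  assumes "U \<noteq> {}" "U \<subseteq> M" "x \<in> M" "y \<in> M"
  shows "infd U x \<le> infd U y + d x y"
proof -
  have "infd U x - d x y \<le> infd U y"
  proof (rule infd_greatest)
    fix u assume u: "u \<in> U"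
    then have "d x u \<le> d x y + d y u"
      using assms by (intro triangle) auto
    then show "infd U x - d x y \<le> d y u"
      using infd_le[OF u, of x] by linarith
  qed (rule assms)
  then show ?thesis by simp
qed

lemma (in Metric_space) infd_attained:
  assumes "finite U" "U \<noteq> {}"
  obtains u where "u \<in> U" "infd U z = d z u"
proof -
  have "infd U z = Min (d z ` U)"
    unfolding infd_def using assms by (simp add: cInf_eq_Min)
  moreover have "Min (d z ` U) \<in> d z ` U"
    using assms by simp
  ultimately show ?thesis
    using that by auto
qed

section \<open>Bumps around a set and their differences\<close>

definition (in Metric_space) bump :: "real \<Rightarrow> 'a set \<Rightarrow> real \<Rightarrow> 'a \<Rightarrow> real"
  where "bump l U a z = max 0 (a - l * infd U z)"

lemma (in Metric_space) bump_diff_le: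
  assumes "U \<noteq> {}" "U \<subseteq> M" "x \<in> M" "y \<in> M" "0 \<le> l"
  shows "bump l U a x - bump l U a y \<le> l * d x y"
proof -
  have "l * infd U y \<le> l * (infd U x + d x y)"
    using infd_triangle[of U y x] assms by (intro mult_left_mono) (auto simp: commute)
  moreover have "0 \<le> l * d x y"
    using assms by simp
  ultimately show ?thesis
    by (auto simp: bump_def max_def algebra_simps)
qed

text \<open>Subtracting does not double the slope. If the first bump vanishes at \<open>x\<close> or
  the second at \<open>y\<close>, the other one alone controls the drop from \<open>x\<close> to
  \<open>y\<close>. Otherwise the path from \<open>U\<close> through \<open>x\<close> and
  \<open>y\<close> to \<open>V\<close> has length at least the gap between \<open>U\<close> and
  \<open>V\<close>, which pays for both heights.\<close>

lemma (in Metric_space) bump_difference_lipschitz: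
  assumes U: "U \<noteq> {}" "U \<subseteq> M" and V: "V \<noteq> {}" "V \<subseteq> M" and l: "0 \<le> l"
    and sep: "\<And>u v. u \<in> U \<Longrightarrow> v \<in> V \<Longrightarrow> a + b \<le> l * d u v"
    and x: "x \<in> M" and y: "y \<in> M"
  shows "\<bar>(bump l U a x - bump l V b x) - (bump l U a y - bump l V b y)\<bar> \<le> l * d x y"
proof -
  have one: "(bump l U a x - bump l V b x) - (bump l U a y - bump l V b y) \<le> l * d x y"
    if x: "x \<in> M" and y: "y \<in> M" for x y
  proof -
    have pos: "0 \<le> bump l U a y" "0 \<le> bump l V b x"
      by (auto simp: bump_def)
    consider "bump l U a x = 0" | "bump l V b y = 0"
      | "bump l U a x = a - l * infd U x" "bump l V b y = b - l * infd V y"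
      unfolding bump_def by linarith
    then show ?thesis
    proof cases
      case 1
      then show ?thesis
        using pos bump_diff_le[OF V y x l, of b] by (simp add: commute)
    next
      case 2
      then show ?thesis
        using pos bump_diff_le[OF U x y l, of a] by simp
    next
      case 3
      have "a + b \<le> l * (infd U x + d x y + infd V y)"
      proof (cases "l = 0")
        case True
        then show ?thesis using sep U(1) V(1) by fastforce
      next
        case False
        have "(a + b) / l - d x y - infd V y \<le> infd U x"
        proof (rule infd_greatest[OF U(1)])
          fix u assume u: "u \<in> U"
          have "(a + b) / l - d x y - d x u \<le> infd V y"
          proof (rule infd_greatest[OF V(1)])
            fix v assume v: "v \<in> V"
            have "d u v \<le> d u x + d x v" "d x v \<le> d x y + d y v"
              using u v U V x y by (auto intro!: triangle)
            moreover have "(a + b) / l \<le> d u v"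
              using sep[OF u v] False l by (simp add: field_simps)
            ultimately show "(a + b) / l - d x y - d x u \<le> d y v"
              by (simp add: commute)
          qed
          then show "(a + b) / l - d x y - infd V y \<le> d x u" by linarith
        qed
        then have "(a + b) / l \<le> infd U x + d x y + infd V y" by linarith
        then show ?thesis
          using False l by (simp add: field_simps)
      qed
      then show ?thesis
        using 3 pos by (simp add: algebra_simps)
    qed
  qed
  show ?thesis
    using one[OF x y] one[OF y x] by (simp add: commute abs_le_iff)
qed

section \<open>Coordinates admissible at one stage\<close>

definition (in Metric_space) coordinate :: "real \<Rightarrow> 'a set \<Rightarrow> ('a \<Rightarrow> real) \<Rightarrow> bool"
  where "coordinate e F f \<longleftrightarrow>
    (\<exists>l<2. \<forall>x\<in>M. \<forall>y\<in>M. \<bar>f x - f y\<bar> \<le> l * d x y) \<and> (\<forall>z\<in>F. \<bar>f z\<bar> \<le> e)"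

lemma (in Metric_space) coordinate_zero: "0 \<le> e \<Longrightarrow> coordinate e F (\<lambda>_. 0)"
  unfolding coordinate_def by (simp add: exI[of _ 0])

lemma (in Metric_space) coordinate_less:
  assumes "coordinate e F f" "x \<in> M" "y \<in> M" "x \<noteq> y"
  shows "\<bar>f x - f y\<bar> < 2 * d x y"
proof -
  obtain l where "l < 2" "\<bar>f x - f y\<bar> \<le> l * d x y"
    using assms unfolding coordinate_def by blast
  moreover have "0 < d x y"
    using assms by simp
  ultimately show ?thesis
    using mult_strict_right_mono[of l 2 "d x y"] by linarith
qed

lemma (in Metric_space) coordinate_bound:
  assumes "coordinate e F f" "x \<in> M" "z \<in> F" "z \<in> M"
  shows "\<bar>f x\<bar> \<le> e + 2 * d x z"
proof -
  have "\<bar>f x - f z\<bar> \<le> 2 * d x z"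
    using coordinate_less[OF assms(1,2,4)] by (cases "x = z") auto
  moreover have "\<bar>f z\<bar> \<le> e"
    using assms unfolding coordinate_def by blast
  ultimately show ?thesis by linarith
qed

section \<open>Separating the pairs of one stage\<close>

text \<open>A bump of height \<open>a\<close> around the first projection minus one of height
  \<open>b\<close> around the second does it, provided that \<open>a + b\<close> is at least
  \<open>t0 + e' / 6\<close>, is at most the slope times the gap between the projections, and is
  split so that both bumps have fallen to \<open>e\<close> on \<open>F\<close>.\<close>

lemma (in Metric_space) class_coordinate:
  assumes F: "F \<noteq> {}" "F \<subseteq> M" and pq: "p \<in> M" "q \<in> M"
    and e: "0 < e'" "e' \<le> e" and t0: "0 \<le> t0" and r0: "0 \<le> r0"
    and EM: "\<And>x y. (x, y) \<in> E \<Longrightarrow> x \<in> M \<and> y \<in> M"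
    and near: "\<And>x y. (x, y) \<in> E \<Longrightarrow> 2 * (d x p + d y q) + e' \<le> d x y"
    and far: "\<And>x y. (x, y) \<in> E \<Longrightarrow> d x y < 2 * (infd F x + infd F y) + e"
    and t: "\<And>x y. (x, y) \<in> E \<Longrightarrow> t0 \<le> d x y \<and> d x y < t0 + e' / 6"
    and r: "\<And>x y. (x, y) \<in> E \<Longrightarrow> r0 \<le> infd F x \<and> infd F x < r0 + e' / 6"
  shows "\<exists>f. coordinate e F f \<and> (\<forall>(x, y)\<in>E. d x y < f x - f y)"
proof (cases "E = {}")
  case True
  then show ?thesis
    using coordinate_zero[of e F] e by force
next
  case False
  define U V where "U = fst ` E" and "V = snd ` E"
  have U: "U \<noteq> {}" "U \<subseteq> M" and V: "V \<noteq> {}" "V \<subseteq> M"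
    using False EM by (auto simp: U_def V_def)
  \<comment> \<open>With this \<tau> the slope times \<open>(t0 + e') / 2\<close>, the gap
    established in \<open>sep\<close>, equals \<open>t0 + e' / 2\<close> and so exceeds
    \<open>c\<close>.\<close>
  define \<tau> where "\<tau> = e' / (t0 + e')"
  define l where "l = 2 - \<tau>"
  have \<tau>: "0 < \<tau>" "\<tau> \<le> 1" "\<tau> * (t0 + e') = e'"
    using e t0 by (auto simp: \<tau>_def)
  have l: "0 \<le> l" "l < 2"
    using \<tau> by (auto simp: l_def)
  have \<tau>t: "\<tau> * t0 + \<tau> * e' \<le> e'"
    using \<tau>(3) unfolding distrib_left by simp
  define c where "c = t0 + e' / 6"
  \<comment> \<open>The counterpart of \<open>r0\<close> for the second projection:
    \<open>far\<close> and the two cell bounds keep its points at least this far from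
    \<open>F\<close>.\<close>
  define s0 where "s0 = max 0 ((t0 - e) / 2 - r0 - e' / 6)"
  \<comment> \<open>The first bump gets as much of the total height \<open>c\<close> as its
    smallness on \<open>F\<close> allows, the second gets the rest; \<open>c_le2\<close> says that
    the rest is small enough.\<close>
  define a where "a = min (l * r0 + e) c"
  define b where "b = c - a"
  have c_le: "c \<le> l * ((t0 + e') / 2)"
    using \<tau>t e(1) unfolding c_def l_def by argo
  have c_le2: "c \<le> (l * r0 + e) + (l * s0 + e)"
  proof -
    have pos: "0 \<le> \<tau> * e" "0 \<le> \<tau> * e'"
      using \<tau> e by auto
    have "(t0 - e) / 2 - e' / 6 \<le> r0 + s0"
      by (simp add: s0_def)
    then have "l * ((t0 - e) / 2 - e' / 6) \<le> l * (r0 + s0)"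
      using l by (intro mult_left_mono)
    \<comment> \<open>The cell of \<open>infd F x\<close> costs \<open>e' / 3\<close> and the slope
      deficit \<tau> at most \<open>e' / 2\<close>. After adding \<open>2 * e\<close>, at least
      \<open>t0 + e' / 6 = c\<close> remains since \<open>e' \<le> e\<close>: cells of width
      \<open>e' / 6\<close> are just narrow enough.\<close>
    moreover have "t0 - e - e' / 3 - e' / 2 \<le> l * ((t0 - e) / 2 - e' / 6)"
      using \<tau>t e pos unfolding l_def by argo
    ultimately have "t0 - e - e' / 3 - e' / 2 \<le> l * (r0 + s0)"
      by linarith
    then show ?thesis
      using e by (simp add: c_def distrib_left)
  qed
  have a: "0 \<le> a" "a \<le> l * r0 + e" and b: "0 \<le> b" "b \<le> l * s0 + e"
  proof -
    have "0 \<le> l * r0" "0 \<le> l * s0" "0 \<le> c"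
      using l r0 e t0 by (auto simp: c_def s0_def)
    then show "0 \<le> a" "a \<le> l * r0 + e" "0 \<le> b" "b \<le> l * s0 + e"
      using e c_le2 unfolding a_def b_def by linarith+
  qed
  have sep: "a + b \<le> l * d u v" if uv: "u \<in> U" "v \<in> V" for u v
  proof -
    obtain y where y: "(u, y) \<in> E"
      using uv(1) by (force simp: U_def)
    obtain x where x: "(x, v) \<in> E"
      using uv(2) by (force simp: V_def)
    have mem: "u \<in> M" "y \<in> M" "x \<in> M" "v \<in> M"
      using EM x y by auto
    \<comment> \<open>Two lower bounds for \<open>d u v\<close>, one by the detour through
      \<open>q\<close> and one through \<open>p\<close>. In their sum the distances to
      \<open>p\<close> and \<open>q\<close> regroup by pairs, so that \<open>near\<close> applies to
      \<open>(u, y)\<close> and to \<open>(x, v)\<close>.\<close>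
    have "d u y \<le> d u v + d v y" "d v y \<le> d v q + d y q"
      using mem pq triangle[of u v y] triangle[of v q y] by (auto simp: commute)
    moreover have "d x v \<le> d x u + d u v" "d x u \<le> d x p + d u p"
      using mem pq triangle[of x u v] triangle[of x p u] by (auto simp: commute)
    ultimately have "(t0 + e') / 2 \<le> d u v"
      using near[OF x] near[OF y] t[OF x] t[OF y] by argo
    then have "l * ((t0 + e') / 2) \<le> l * d u v"
      using l by (intro mult_left_mono)
    then show ?thesis
      using c_le by (simp add: b_def)
  qed
  define f where "f = (\<lambda>z. bump l U a z - bump l V b z)"
  have "\<bar>f z\<bar> \<le> e" if z: "z \<in> F" for z
  proof -
    have "r0 \<le> infd U z"
    proof (rule infd_greatest[OF U(1)])
      fix u assume "u \<in> U"
      then show "r0 \<le> d z u"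
        using r infd_le[OF z, of u] by (force simp: U_def commute)
    qed
    then have "l * r0 \<le> l * infd U z"
      using l by (intro mult_left_mono)
    then have 1: "bump l U a z \<le> e"
      using a e by (auto simp: bump_def)
    have "s0 \<le> infd V z"
    proof (rule infd_greatest[OF V(1)])
      fix v assume "v \<in> V"
      then obtain x where x: "(x, v) \<in> E" by (force simp: V_def)
      have "(t0 - e) / 2 - r0 - e' / 6 \<le> infd F v"
        using far[OF x] t[OF x] r[OF x] by argo
      then have "s0 \<le> infd F v"
        using infd_nonneg[OF F(1), of v] by (simp add: s0_def)
      then show "s0 \<le> d z v"
        using infd_le[OF z, of v] by (simp add: commute)
    qed
    then have "l * s0 \<le> l * infd V z"
      using l by (intro mult_left_mono)
    then have 2: "bump l V b z \<le> e"
      using b e by (auto simp: bump_def)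
    have "0 \<le> bump l U a z" "0 \<le> bump l V b z"
      by (auto simp: bump_def)
    then show ?thesis
      using 1 2 by (simp add: f_def abs_le_iff)
  qed
  then have "coordinate e F f"
    unfolding coordinate_def f_def
    using bump_difference_lipschitz[OF U V l(1) sep] l(2) by blast
  moreover have "d x y < f x - f y" if xy: "(x, y) \<in> E" for x y
  proof -
    have x: "x \<in> U" and y: "y \<in> V"
      using xy by (force simp: U_def V_def)+
    have ab: "a + b \<le> l * infd V x" "a + b \<le> l * infd U y"
    proof -
      have l0: "0 < l" using \<tau> by (simp add: l_def)
      have "(a + b) / l \<le> infd V x"
        using sep[OF x] l0 by (intro infd_greatest[OF V(1)]) (simp add: field_simps)
      then show "a + b \<le> l * infd V x"
        using l0 by (simp add: field_simps)
      have "(a + b) / l \<le> infd U y"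
        using sep[OF _ y] l0
        by (intro infd_greatest[OF U(1)]) (simp add: field_simps commute)
      then show "a + b \<le> l * infd U y"
        using l0 by (simp add: field_simps)
    qed
    \<comment> \<open>Each bump peaks on its own projection and vanishes on the other.\<close>
    have "f x = a" "f y = - b"
      using ab a b infd_zero[OF x U(2)] infd_zero[OF y V(2)] by (auto simp: f_def bump_def)
    then show ?thesis
      using t[OF xy] by (simp add: b_def c_def)
  qed
  ultimately show ?thesis by blast
qed

text \<open>One function per class suffices. A class fixes nearest points in the finite set
  \<open>G\<close> and the values of \<open>d x y\<close> and \<open>infd F x\<close> rounded down
  to multiples of \<eta>; the second condition bounds both by \<open>2 * D\<close>, leaving finitely
  many classes.\<close>

lemma (in Metric_space) stage_coordinates:
  assumes F: "F \<noteq> {}" "F \<subseteq> G" and G: "finite G" "G \<subseteq> M" and e: "0 < e'" "e' \<le> e"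
  shows "\<exists>\<Phi>. finite \<Phi> \<and> (\<forall>f\<in>\<Phi>. coordinate e F f) \<and>
    (\<forall>x\<in>M. \<forall>y\<in>M. d x y < 2 * (infd F x + infd F y) + e \<longrightarrow>
      2 * (infd G x + infd G y) + e' \<le> d x y \<longrightarrow> (\<exists>f\<in>\<Phi>. d x y < f x - f y))"
proof -
  define D where "D = Max ((\<lambda>(p, q). d p q) ` (G \<times> G))"
  define \<eta> where "\<eta> = e' / 6"
  have \<eta>: "0 < \<eta>" using e by (simp add: \<eta>_def)
  define K where "K = nat \<lfloor>2 * D / \<eta>\<rfloor>"
  have Gne: "G \<noteq> {}" using F by auto
  have D: "d p q \<le> D" if "p \<in> G" "q \<in> G" for p q
    unfolding D_def using that G by (intro Max_ge) (auto simp: image_iff)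
  have FM: "F \<subseteq> M" using F G by auto
  define I where "I = G \<times> G \<times> {..K} \<times> {..K}"
  define E where "E = (\<lambda>(p, q, i, j). {(x, y). x \<in> M \<and> y \<in> M \<and>
    2 * (d x p + d y q) + e' \<le> d x y \<and> d x y < 2 * (infd F x + infd F y) + e \<and>
    nat \<lfloor>d x y / \<eta>\<rfloor> = i \<and> nat \<lfloor>infd F x / \<eta>\<rfloor> = j})"
  have cell: "real k * \<eta> \<le> s \<and> s < real k * \<eta> + e' / 6"
    if "nat \<lfloor>s / \<eta>\<rfloor> = k" "0 \<le> s" for s k
  proof -
    have "real k = of_int \<lfloor>s / \<eta>\<rfloor>"
      using that \<eta> by auto
    then have "real k \<le> s / \<eta>" "s / \<eta> < real k + 1"
      by linarith+
    then show ?thesis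
      using \<eta> by (auto simp: field_simps \<eta>_def[symmetric])
  qed
  define sep where "sep w f \<longleftrightarrow> coordinate e F f \<and> (\<forall>(x, y)\<in>E w. d x y < f x - f y)" for w f
  have "\<exists>f. sep w f" if w: "w \<in> I" for w
  proof -
    obtain p q i j where w': "w = (p, q, i, j)" "p \<in> G" "q \<in> G"
      using w by (auto simp: I_def)
    show ?thesis
      unfolding sep_def
    proof (rule class_coordinate[of F p q e' e "real i * \<eta>" "real j * \<eta>"])
      show "real i * \<eta> \<le> d x y \<and> d x y < real i * \<eta> + e' / 6" if "(x, y) \<in> E w" for x y
        using that by (intro cell) (auto simp: E_def w')
      show "real j * \<eta> \<le> infd F x \<and> infd F x < real j * \<eta> + e' / 6" if "(x, y) \<in> E w" for x y
        using that F by (intro cell) (auto simp: E_def w' infd_nonneg)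
    qed (use F FM w' G e \<eta> in \<open>auto simp: E_def\<close>)
  qed
  then obtain \<phi> where \<phi>: "\<And>w. w \<in> I \<Longrightarrow> sep w (\<phi> w)"
    by metis
  have "\<exists>f\<in>\<phi> ` I. d x y < f x - f y"
    if x: "x \<in> M" and y: "y \<in> M" and far: "d x y < 2 * (infd F x + infd F y) + e"
      and near: "2 * (infd G x + infd G y) + e' \<le> d x y" for x y
  proof -
    obtain p where p: "p \<in> G" "infd G x = d x p"
      using infd_attained[OF G(1) Gne] by blast
    obtain q where q: "q \<in> G" "infd G y = d y q"
      using infd_attained[OF G(1) Gne] by blast
    obtain z where z: "z \<in> F" using F by auto
    have mem: "p \<in> M" "q \<in> M" "z \<in> M" "z \<in> G"
      using p q z F G by auto
    have "d x y \<le> d x p + d p y" "d p y \<le> d p q + d y q"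
      using x y mem triangle[of x p y] triangle[of p q y] by (auto simp: commute)
    \<comment> \<open>By \<open>near\<close>, \<open>d x p + d y q\<close> is at most half of
      \<open>d x y\<close>, so \<open>d p q\<close> accounts for the other half.\<close>
    then have dD: "d x y \<le> 2 * D"
      using near p q e D[of p q] by simp
    have "infd F x \<le> d x z"
      by (rule infd_le[OF z])
    also have "\<dots> \<le> d x p + d p z"
      using x mem by (intro triangle)
    also have "\<dots> \<le> 2 * D"
    proof -
      have "d x p \<le> D"
        using near dD e(1) nonneg[of y q] unfolding p(2) q(2) by argo
      then show ?thesis
        using D[of p z] p mem by linarith
    qed
    finally have rD: "infd F x \<le> 2 * D" .
    have K: "nat \<lfloor>s / \<eta>\<rfloor> \<le> K" if "s \<le> 2 * D" for s
      unfolding K_def using that \<eta> by (intro nat_mono floor_mono divide_right_mono) auto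
    define w where "w = (p, q, nat \<lfloor>d x y / \<eta>\<rfloor>, nat \<lfloor>infd F x / \<eta>\<rfloor>)"
    have "w \<in> I"
      using p q K[OF dD] K[OF rD] by (auto simp: w_def I_def)
    moreover have "(x, y) \<in> E w"
      using x y near far p q by (auto simp: E_def w_def)
    ultimately show ?thesis
      using \<phi>[of w] unfolding sep_def by blast
  qed
  moreover have "finite (\<phi> ` I)"
    using G by (simp add: I_def)
  ultimately show ?thesis
    using \<phi> unfolding sep_def by (intro exI[of _ "\<phi> ` I"]) blast
qed

section \<open>Assembling all stages into null sequences\<close>

lemma (in Metric_space) coordinates_exist:
  fixes a :: "nat \<Rightarrow> 'a"
  assumes aM: "range a \<subseteq> M"
    and dense: "\<And>x e. x \<in> M \<Longrightarrow> 0 < e \<Longrightarrow> \<exists>n. d x (a n) < e"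
  shows "\<exists>g :: nat \<Rightarrow> 'a \<Rightarrow> real. (\<forall>x\<in>M. (\<lambda>n. g n x) \<longlonglongrightarrow> 0) \<and>
    (\<forall>x\<in>M. \<forall>y\<in>M. x \<noteq> y \<longrightarrow> (\<exists>n. d x y < g n x - g n y) \<and>
      (\<forall>n. \<bar>g n x - g n y\<bar> < 2 * d x y))"
proof -
  define F where "F n = a ` {..n}" for n :: nat
  define \<delta> where "\<delta> n = inverse (real (Suc n))" for n
  have \<delta>: "0 < \<delta> n" "\<delta> (Suc n) \<le> \<delta> n" for n
    by (auto simp: \<delta>_def field_simps)
  have F: "F n \<noteq> {}" "F n \<subseteq> F (Suc n)" "finite (F n)" "F n \<subseteq> M" for n
    using aM by (auto simp: F_def)
  define near where "near n x y \<longleftrightarrow> 2 * (infd (F n) x + infd (F n) y) + \<delta> n \<le> d x y" for n x y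
  define stage where "stage n \<Phi> \<longleftrightarrow> (\<forall>f\<in>\<Phi>. coordinate (\<delta> n) (F n) f) \<and>
    (\<forall>x\<in>M. \<forall>y\<in>M. \<not> near n x y \<longrightarrow> near (Suc n) x y \<longrightarrow> (\<exists>f\<in>\<Phi>. d x y < f x - f y))" for n \<Phi>
  have "\<exists>\<Phi>. finite \<Phi> \<and> stage n \<Phi>" for n
    using stage_coordinates[OF F(1,2) F(3,4) \<delta>, of n]
    by (simp only: stage_def near_def not_le)
  then have "\<exists>fs. stage n (set fs)" for n
    by (metis finite_list)
  then obtain L where stage: "\<And>n. stage n (set (L n))"
    by metis
  then have L: "\<And>n f. f \<in> set (L n) \<Longrightarrow> coordinate (\<delta> n) (F n) f"
    and sep: "\<And>n x y. x \<in> M \<Longrightarrow> y \<in> M \<Longrightarrow> \<not> near n x y \<Longrightarrow> near (Suc n) x y \<Longrightarrow>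
      \<exists>f\<in>set (L n). d x y < f x - f y"
    unfolding stage_def by blast+
  \<comment> \<open>Padding with the zero function, itself admissible, lets the index pairs range
    over all of \<open>nat \<times> nat\<close>.\<close>
  define h where "h = (\<lambda>(n, k). if k < length (L n) then L n ! k else (\<lambda>_. 0))"
  define g where "g m = h (prod_decode m)" for m
  have h: "coordinate (\<delta> n) (F n) (h (n, k))" for n k
    using L[of _ n] coordinate_zero[of "\<delta> n" "F n"] \<delta>(1)[of n] by (auto simp: h_def)
  have ev: "\<exists>N. \<forall>n\<ge>N. \<exists>z\<in>F n. d x z < e" if x: "x \<in> M" "0 < e" for x e
  proof -
    obtain N where "d x (a N) < e"
      using dense[OF x] by blast
    then show ?thesis
      by (intro exI[of _ N]) (auto simp: F_def)
  qed
  have ev\<delta>: "\<exists>N. \<forall>n\<ge>N. \<delta> n < e" if "0 < e" for e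
    using order_tendstoD(2)[OF LIMSEQ_inverse_real_of_nat that]
    by (simp add: \<delta>_def eventually_sequentially)
  have "(\<lambda>m. g m x) \<longlonglongrightarrow> 0" if x: "x \<in> M" for x
  proof (rule LIMSEQ_I)
    fix e :: real assume e: "0 < e"
    obtain N1 where N1: "\<And>n. n \<ge> N1 \<Longrightarrow> \<exists>z\<in>F n. d x z < e / 4"
      using ev[OF x, of "e / 4"] e by auto
    obtain N2 where N2: "\<And>n. n \<ge> N2 \<Longrightarrow> \<delta> n < e / 2"
      using ev\<delta>[of "e / 2"] e by auto
    define N where "N = max N1 N2"
    \<comment> \<open>The only indices whose coordinate may be large at \<open>x\<close>: the
      genuine ones of stages up to \<open>N\<close>. The others are padding, or lie in a stage where
      \<delta> and twice the distance to a point of \<open>F n\<close> are both below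
      \<open>e / 2\<close>.\<close>
    define B where "B = prod_encode ` (SIGMA n:{..N}. {..<length (L n)})"
    have small: "\<bar>g m x\<bar> < e" if mB: "m \<notin> B" for m
    proof -
      obtain n k where nk: "prod_decode m = (n, k)"
        by force
      then have m: "m = prod_encode (n, k)"
        by (metis prod_decode_inverse)
      consider "k \<ge> length (L n)" | "n > N"
        using mB unfolding B_def m by force
      then show ?thesis
      proof cases
        case 1
        then show ?thesis
          using e by (simp add: g_def nk h_def)
      next
        case 2
        then obtain z where z: "z \<in> F n" "d x z < e / 4"
          using N1[of n] by (auto simp: N_def)
        have "\<bar>h (n, k) x\<bar> \<le> \<delta> n + 2 * d x z"
          using h x z F(4) by (intro coordinate_bound) auto
        then show ?thesis
          using z N2[of n] 2 by (simp add: N_def g_def nk)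
      qed
    qed
    have "finite B"
      by (simp add: B_def)
    then obtain N' where "\<forall>m\<in>B. m < N'"
      by (metis finite_nat_set_iff_bounded)
    then show "\<exists>N. \<forall>m\<ge>N. norm (g m x - 0) < e"
      using small by (intro exI[of _ N']) (auto simp: not_less[symmetric])
  qed
  moreover have "\<exists>m. d x y < g m x - g m y" if x: "x \<in> M" and y: "y \<in> M" and "x \<noteq> y" for x y
  proof -
    have dp: "0 < d x y / 6"
      using that by simp
    have "\<exists>n. near n x y"
    proof -
      obtain N1 where N1: "\<And>n. n \<ge> N1 \<Longrightarrow> \<exists>z\<in>F n. d x z < d x y / 6"
        using ev[OF x dp] by auto
      obtain N2 where N2: "\<And>n. n \<ge> N2 \<Longrightarrow> \<exists>z\<in>F n. d y z < d x y / 6"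
        using ev[OF y dp] by auto
      obtain N3 where N3: "\<And>n. n \<ge> N3 \<Longrightarrow> \<delta> n < d x y / 6"
        using ev\<delta>[OF dp] by auto
      define n where "n = max N1 (max N2 N3)"
      have n: "n \<ge> N1" "n \<ge> N2" "n \<ge> N3"
        by (auto simp: n_def)
      obtain z where z: "z \<in> F n" "d x z < d x y / 6"
        using N1[OF n(1)] by blast
      obtain z' where z': "z' \<in> F n" "d y z' < d x y / 6"
        using N2[OF n(2)] by blast
      \<comment> \<open>The left-hand side of \<open>near\<close> stays below 5/6 of
        \<open>d x y\<close>.\<close>
      have "near n x y"
        using z(2) z'(2) N3[OF n(3)] infd_le[OF z(1), of x] infd_le[OF z'(1), of y] dp
        unfolding near_def by argo
      then show ?thesis ..
    qed
    moreover have "\<not> near 0 x y"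
    proof -
      have inf0: "infd (F 0) u = d u (a 0)" for u
        by (simp add: infd_def F_def)
      \<comment> \<open>As \<open>F 0\<close> is the single point \<open>a 0\<close>, the triangle
        inequality excludes \<open>near 0\<close>.\<close>
      have "d x y \<le> d x (a 0) + d y (a 0)"
        using triangle[of x "a 0" y] x y aM by (auto simp: commute)
      then show ?thesis
        using \<delta>(1)[of 0] nonneg[of x "a 0"] nonneg[of y "a 0"] unfolding near_def inf0 by argo
    qed
    \<comment> \<open>The stage at which \<open>near\<close> first turns true serves the
      pair.\<close>
    ultimately obtain n where "\<not> near n x y" "near (Suc n) x y"
      using ex_least_nat_less[of "\<lambda>n. near n x y"] by blast
    then obtain f where f: "f \<in> set (L n)" "d x y < f x - f y"
      using sep[OF x y] by blast
    then obtain k where "k < length (L n)" "L n ! k = f"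
      by (metis in_set_conv_nth)
    then have "g (prod_encode (n, k)) = f"
      by (simp add: g_def h_def)
    then show ?thesis
      using f by blast
  qed
  moreover have "\<bar>g m x - g m y\<bar> < 2 * d x y" if "x \<in> M" "y \<in> M" "x \<noteq> y" for m x y
    unfolding g_def using coordinate_less[OF h that] by (metis surj_pair)
  ultimately show ?thesis
    by blast
qed

section \<open>Passage to the norm of \<open>c0\<close>\<close>

text \<open>Strictness survives the supremum because all but finitely many terms are below
  \<open>c / 2\<close>, and a maximum of finitely many numbers below \<open>c\<close> is below
  \<open>c\<close>.\<close>

lemma norm_c0_less:
  assumes u: "u \<in> c0" and less: "\<And>n. \<bar>apply_bcontfun u n\<bar> < c"
  shows "norm u < c"
proof -
  have c: "0 < c"
    using less[of 0] by simp
  obtain N where N: "\<And>n. n \<ge> N \<Longrightarrow> \<bar>apply_bcontfun u n\<bar> < c / 2"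
    using u c LIMSEQ_D[of "apply_bcontfun u" 0 "c / 2"] by (auto simp: c0_def)
  define m where "m = Max (insert (c / 2) ((\<lambda>n. \<bar>apply_bcontfun u n\<bar>) ` {..<N}))"
  have "\<bar>apply_bcontfun u n\<bar> \<le> m" for n
  proof (cases "n < N")
    case True
    then show ?thesis
      unfolding m_def by (intro Max_ge) auto
  next
    case False
    then have "\<bar>apply_bcontfun u n\<bar> \<le> c / 2"
      using N[of n] by simp
    also have "\<dots> \<le> m"
      unfolding m_def by (intro Max_ge) auto
    finally show ?thesis .
  qed
  then have "norm u \<le> m"
    unfolding norm_bcontfun_eq_SUP by (intro cSUP_least) auto
  also have "m < c"
    unfolding m_def using less c by (subst Max_less_iff) auto
  finally show ?thesis .
qed

theorem corollary4p3:
  fixes M :: "'a set" and d :: "'a \<Rightarrow> 'a \<Rightarrow> real"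
  assumes "Metric_space M d"
    and "separable_space (Metric_space.mtopology M d)"
  shows "\<exists>f :: 'a \<Rightarrow> (nat \<Rightarrow>\<^sub>C real). f \<in> M \<rightarrow> c0 \<and>
    (\<forall>x\<in>M. \<forall>y\<in>M. x \<noteq> y \<longrightarrow>
      d x y < norm (f x - f y) \<and> norm (f x - f y) < 2 * d x y)"
proof (cases "M = {}")
  case False
  interpret Metric_space M d by fact
  obtain C where C: "countable C" "C \<subseteq> M" "mtopology closure_of C = M"
    using assms(2) by (auto simp: separable_space_def)
  have dense: "\<exists>y\<in>C. d x y < e" if "x \<in> M" "0 < e" for x e
    using C(3) that by (fastforce simp: metric_closure_of)
  then have "C \<noteq> {}"
    using False by (metis empty_iff equals0I zero_less_one)
  \<comment> \<open>If \<open>C\<close> is finite the enumeration repeats points, which does no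
    harm.\<close>
  then have ran: "range (from_nat_into C) = C"
    using C(1) by (rule range_from_nat_into)
  have "range (from_nat_into C) \<subseteq> M"
    using ran C(2) by simp
  moreover have "\<exists>n. d x (from_nat_into C n) < e" if "x \<in> M" "0 < e" for x e
    using dense[OF that] ran by (metis imageE)
  ultimately obtain g where lim: "\<And>x. x \<in> M \<Longrightarrow> (\<lambda>n. g n x) \<longlonglongrightarrow> (0::real)"
    and lower: "\<And>x y. x \<in> M \<Longrightarrow> y \<in> M \<Longrightarrow> x \<noteq> y \<Longrightarrow> \<exists>n. d x y < g n x - g n y"
    and upper: "\<And>n x y. x \<in> M \<Longrightarrow> y \<in> M \<Longrightarrow> x \<noteq> y \<Longrightarrow> \<bar>g n x - g n y\<bar> < 2 * d x y"
    using coordinates_exist by metis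
  obtain f where f: "\<And>x. x \<in> M \<Longrightarrow> f x \<in> c0 \<and> apply_bcontfun (f x) = (\<lambda>n. g n x)"
    using c0_surj[OF lim] by metis
  have "d x y < norm (f x - f y) \<and> norm (f x - f y) < 2 * d x y"
    if xy: "x \<in> M" "y \<in> M" "x \<noteq> y" for x y
  proof
    have app: "apply_bcontfun (f x - f y) n = g n x - g n y" for n
      using f xy by (simp add: minus_bcontfun.rep_eq)
    obtain n where "d x y < g n x - g n y"
      using lower[OF xy] by blast
    also have "\<dots> \<le> norm (apply_bcontfun (f x - f y) n)"
      unfolding app by simp
    also have "\<dots> \<le> norm (f x - f y)"
      by (rule norm_bounded)
    finally show "d x y < norm (f x - f y)" .
    have "f x - f y \<in> c0"
      using f xy subspace_c0 by (simp add: subspace_diff)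
    then show "norm (f x - f y) < 2 * d x y"
      using upper[OF xy] unfolding app[symmetric] by (intro norm_c0_less)
  qed
  then show ?thesis
    using f by (intro exI[of _ f]) auto
qed auto

end
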